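(* Let $i:M\to\mathbb{R}^n$, $i(p)=p$, be a submanifold, where $M$ has the metric induced by $\mathbb{R}^n$, and let $f:M\to\mathbb{R}$ be an eikonal function. Define $\phi:M\to\mathbb{R}^n\times\mathbb{R}$ by $\phi(p)=(i(p),f(p))$. Let $\alpha:I\subset\mathbb{R}\to M$ be a unit speed curve (parametrized by arc length $s$) on $M$ with unit tangent $T$. Then $\alpha$ is an $f$-eikonal helix curve if and only if the curve $$\beta(s)=\phi(\alpha(s))=\big(i(\alpha(s)),f(\alpha(s))\big)\in\mathbb{R}^n\times\mathbb{R}$$ is a general helix with the axis $d=(0,1)\in\mathbb{R}^n\times\mathbb{R}$.
   Context: $\nabla f$ is the gradient of $f$ on $M$, i.e. $df(X)=\langle\nabla f,X\rangle$ for $X\in TM$; $f$ is eikonal if $\|\nabla f\|$ is constant. The curve $\alpha$ with unit tangent $T$ is an $f$-eikonal helix curve if $\|\nabla f\|$ is constant along $\alpha$ and the angle between $\nabla f$ and $T$ is constant along $\alpha$. A curve in a Euclidean space $E^m$ with unit tangent vector $V_1$ is a general helix with axis the constant unit vector $X\in E^m$ if $\langle V_1,X\rangle=\cos\varphi$ along the curve, where $\varphi$ is constant and $\varphi\neq\frac{\pi}{2}$. Here $m=n+1$, $E^m=\mathbb{R}^n\times\mathbb{R}$, $X=d$, and $V_1=\beta'/\|\beta'\|$ is the unit tangent of $\beta$ (the parameter $s$ is arc length for $\alpha$, not necessarily for $\beta$).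
   Formalization: Adds that ⟨∇f,T⟩ is not identically zero along α; without it the claim fails: for M=R², f(x,y)=y, α(s)=(s,0), α is an f-eikonal helix curve (angle π/2), but β has φ=π/2, so it is not a general helix. *)

theory Defs
  imports "HOL-Analysis.Analysis"
begin

section \<open>Smooth maps\<close>

text \<open>\<open>C_on k g U\<close> is meant for open \<open>U\<close> in a Euclidean space: all iterated directional
  derivatives of \<open>g\<close> up to order \<open>k\<close> exist and are continuous on \<open>U\<close>.\<close>

primrec C_on ::
  "nat \<Rightarrow> ('a::euclidean_space \<Rightarrow> 'b::euclidean_space) \<Rightarrow> 'a set \<Rightarrow> bool" where
  "C_on 0 g U \<longleftrightarrow> continuous_on U g"
| "C_on (Suc k) g U \<longleftrightarrow>
     g differentiable_on U \<and> (\<forall>v. C_on k (\<lambda>x. frechet_derivative g (at x) v) U)"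

text \<open>Smoothness on an arbitrary subset of a Euclidean space, by local smooth extensions. On open
  sets this is the usual notion; on an embedded submanifold it is smoothness in charts; on an
  interval it allows endpoints.\<close>

definition smooth_on ::
  "'a::euclidean_space set \<Rightarrow> ('a \<Rightarrow> 'b::euclidean_space) \<Rightarrow> bool" where
  "smooth_on S f \<longleftrightarrow>
     (\<forall>x\<in>S. \<exists>U g. open U \<and> x \<in> U \<and> (\<forall>k. C_on k g U) \<and> (\<forall>y\<in>S \<inter> U. g y = f y))"


section \<open>Submanifolds of a Euclidean space, with the induced metric\<close>

text \<open>Smooth embedded submanifolds without boundary: near each point a diffeomorphism between open
  sets of the ambient space straightens \<open>M\<close> to a linear subspace of dimension \<open>k\<close>.\<close>

definition submanifold :: "nat \<Rightarrow> 'a::euclidean_space set \<Rightarrow> bool" where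
  "submanifold k M \<longleftrightarrow>
     (\<forall>p\<in>M. \<exists>U (V :: 'a set) h h' S. open U \<and> p \<in> U \<and> open V \<and>
        homeomorphism U V h h' \<and> smooth_on U h \<and> smooth_on V h' \<and>
        subspace S \<and> dim S = k \<and> h ` (U \<inter> M) = V \<inter> S)"

definition represents ::
  "'a::euclidean_space set \<Rightarrow> 'a \<Rightarrow> (real \<Rightarrow> 'a) \<Rightarrow> 'a \<Rightarrow> bool" where
  "represents M p \<gamma> X \<longleftrightarrow>
     (\<exists>e>0. smooth_on {-e<..<e} \<gamma> \<and> \<gamma> ` {-e<..<e} \<subseteq> M) \<and>
     \<gamma> 0 = p \<and> (\<gamma> has_vector_derivative X) (at 0)"

definition tangent_space :: "'a::euclidean_space set \<Rightarrow> 'a \<Rightarrow> 'a set" where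
  "tangent_space M p = {X. \<exists>\<gamma>. represents M p \<gamma> X}"

definition differential ::
  "'a::euclidean_space set \<Rightarrow> ('a \<Rightarrow> real) \<Rightarrow> 'a \<Rightarrow> 'a \<Rightarrow> real" where
  "differential M f p X =
     (THE y. \<forall>\<gamma>. represents M p \<gamma> X \<longrightarrow>
        ((\<lambda>t. f (\<gamma> t)) has_real_derivative y) (at 0))"

text \<open>The metric on \<open>M\<close> is the restriction of the ambient inner product to the tangent spaces.
  The gradient depends only on the values of \<open>f\<close> on \<open>M\<close>.\<close>

definition gradient ::
  "'a::euclidean_space set \<Rightarrow> ('a \<Rightarrow> real) \<Rightarrow> 'a \<Rightarrow> 'a" where
  "gradient M f p =
     (THE v. v \<in> tangent_space M p \<and>
        (\<forall>X\<in>tangent_space M p. differential M f p X = v \<bullet> X))"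

definition eikonal :: "'a::euclidean_space set \<Rightarrow> ('a \<Rightarrow> real) \<Rightarrow> bool" where
  "eikonal M f \<longleftrightarrow> (\<lambda>p. norm (gradient M f p)) constant_on M"


section \<open>Curves\<close>

text \<open>The derivative is taken within the parameter interval, so it is one-sided at an endpoint.\<close>

definition velocity :: "real set \<Rightarrow> (real \<Rightarrow> 'a::real_normed_vector) \<Rightarrow> real \<Rightarrow> 'a" where
  "velocity I \<gamma> s = vector_derivative \<gamma> (at s within I)"

definition unit_tangent :: "real set \<Rightarrow> (real \<Rightarrow> 'a::real_normed_vector) \<Rightarrow> real \<Rightarrow> 'a" where
  "unit_tangent I \<gamma> s = velocity I \<gamma> s /\<^sub>R norm (velocity I \<gamma> s)"

definition unit_speed_curve ::
  "'a::euclidean_space set \<Rightarrow> real set \<Rightarrow> (real \<Rightarrow> 'a) \<Rightarrow> bool" where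
  "unit_speed_curve M I \<alpha> \<longleftrightarrow>
     smooth_on I \<alpha> \<and> \<alpha> ` I \<subseteq> M \<and> (\<forall>s\<in>I. norm (velocity I \<alpha> s) = 1)"

text \<open>If \<open>u\<close> or \<open>v\<close> is zero, this evaluates to \<open>pi / 2\<close>.\<close>

definition vec_angle :: "'a::real_inner \<Rightarrow> 'a \<Rightarrow> real" where
  "vec_angle u v = arccos ((u \<bullet> v) / (norm u * norm v))"

definition eikonal_helix_curve ::
  "'a::euclidean_space set \<Rightarrow> ('a \<Rightarrow> real) \<Rightarrow> real set \<Rightarrow> (real \<Rightarrow> 'a) \<Rightarrow> bool" where
  "eikonal_helix_curve M f I \<alpha> \<longleftrightarrow>
     (\<lambda>s. norm (gradient M f (\<alpha> s))) constant_on I \<and>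
     (\<lambda>s. vec_angle (gradient M f (\<alpha> s)) (unit_tangent I \<alpha> s)) constant_on I"

text \<open>The range \<open>[0, pi]\<close> is that of angles between vectors; without it, \<open>\<phi> \<noteq> pi / 2\<close> would not
  exclude a tangent orthogonal to the axis (take \<open>\<phi> = 3 * pi / 2\<close>).\<close>

definition general_helix ::
  "real set \<Rightarrow> (real \<Rightarrow> 'a::real_inner) \<Rightarrow> 'a \<Rightarrow> bool" where
  "general_helix I \<beta> X \<longleftrightarrow>
     norm X = 1 \<and>
     (\<forall>s\<in>I. \<beta> differentiable (at s within I) \<and> velocity I \<beta> s \<noteq> 0) \<and>
     (\<exists>\<phi>. 0 \<le> \<phi> \<and> \<phi> \<le> pi \<and> \<phi> \<noteq> pi / 2 \<and>
        (\<forall>s\<in>I. unit_tangent I \<beta> s \<bullet> X = cos \<phi>))"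

definition graph_map :: "('a \<Rightarrow> real) \<Rightarrow> 'a \<Rightarrow> 'a \<times> real" where
  "graph_map f p = (p, f p)"

end

theory Submission
  imports Defs
begin

text \<open>Put \<open>c = \<nabla>f \<bullet> T\<close>. By the chain rule \<open>\<beta>' = (T, c)\<close>, so the unit tangent of \<open>\<beta>\<close>
  has component \<open>c / sqrt (1 + c\<^sup>2)\<close> along the axis, an injective function of \<open>c\<close>. The cosine of
  the angle between \<open>\<nabla>f\<close> and \<open>T\<close> is \<open>c\<close> divided by the constant \<open>norm (\<nabla>f)\<close>. Hence both
  conditions say that \<open>c\<close> is constant along \<open>\<alpha>\<close>.\<close>

section \<open>Smooth maps and their restrictions to lines\<close>

text \<open>On an open set the Frechet derivative at a point depends only on values nearby, so
  agreement passes to all directional derivatives. The lemma lets a chain rule formula that holds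
  only on \<open>U\<close> replace the derivative in the induction below.\<close>

lemma C_on_cong:
  assumes "open U" "\<And>x. x \<in> U \<Longrightarrow> f x = g x" "C_on k f U"
  shows "C_on k g U"
  using assms(2,3)
proof (induction k arbitrary: f g)
  case 0
  then show ?case
    by (auto cong: continuous_on_cong)
next
  case (Suc k)
  have diff: "f differentiable at x" if "x \<in> U" for x
    using Suc.prems that assms(1) by (auto simp: differentiable_on_eq_differentiable_at)
  have "g differentiable at x" if "x \<in> U" for x
    using diff[OF that] has_derivative_transform_within_open[of f _ x UNIV U g] assms(1) that
      Suc.prems(1) unfolding differentiable_def by blast
  moreover have "frechet_derivative f (at x) = frechet_derivative g (at x)" if "x \<in> U" for x
    using frechet_derivative_transform_within_open[OF diff[OF that] assms(1) that] Suc.prems(1)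
    by blast
  then have "C_on k (\<lambda>x. frechet_derivative g (at x) v) U" for v
    using Suc.IH[of "\<lambda>x. frechet_derivative f (at x) v" "\<lambda>x. frechet_derivative g (at x) v"]
      Suc.prems(2) by auto
  ultimately show ?case
    using assms(1) by (simp add: differentiable_on_eq_differentiable_at)
qed

text \<open>For an affine inner map the derivative in direction \<open>v\<close> is again a
  directional derivative of \<open>g\<close> along the same line, in the fixed direction
  \<open>v\<close> times \<open>w\<close>. No product rule terms arise, so the induction hypothesis
  applies directly.\<close>

lemma C_on_compose_line:
  assumes "open U" "C_on k g U"
  shows "C_on k (\<lambda>t::real. g (a + t *\<^sub>R w)) ((\<lambda>t. a + t *\<^sub>R w) -` U)"
  using assms(2)
proof (induction k arbitrary: g)
  case 0
  then show ?case
    by (auto intro!: continuous_intros elim!: continuous_on_compose2)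
next
  case (Suc k)
  let ?l = "\<lambda>t::real. a + t *\<^sub>R w"
  have open_pre: "open (?l -` U)"
    by (intro open_vimage continuous_intros assms(1))
  have deriv: "((\<lambda>t. g (?l t)) has_derivative (\<lambda>v. frechet_derivative g (at (?l t)) (v *\<^sub>R w))) (at t)"
    if "?l t \<in> U" for t
  proof -
    have "(g has_derivative frechet_derivative g (at (?l t))) (at (?l t))"
      using Suc.prems that assms(1)
      by (auto simp: differentiable_on_eq_differentiable_at frechet_derivative_works)
    moreover have "(?l has_derivative (\<lambda>v. v *\<^sub>R w)) (at t)"
      by (auto intro!: derivative_eq_intros)
    ultimately show ?thesis
      using diff_chain_at by (fastforce simp: o_def)
  qed
  have "C_on k (\<lambda>t. frechet_derivative (\<lambda>t. g (?l t)) (at t) v) (?l -` U)" for v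
  proof (rule C_on_cong[OF open_pre])
    show "C_on k (\<lambda>t. frechet_derivative g (at (?l t)) (v *\<^sub>R w)) (?l -` U)"
      using Suc.IH[of "\<lambda>x. frechet_derivative g (at x) (v *\<^sub>R w)"] Suc.prems by simp
    show "frechet_derivative g (at (?l t)) (v *\<^sub>R w) = frechet_derivative (\<lambda>t. g (?l t)) (at t) v"
      if "t \<in> ?l -` U" for t
      using frechet_derivative_at[OF deriv] that by (metis vimage_eq)
  qed
  moreover have "(\<lambda>t. g (?l t)) differentiable_on (?l -` U)"
    using deriv open_pre by (auto simp: differentiable_on_eq_differentiable_at differentiable_def)
  ultimately show ?case
    by simp
qed

lemma smooth_on_compose_line:
  fixes J :: "real set"
  assumes "smooth_on V g" "\<And>t. t \<in> J \<Longrightarrow> a + t *\<^sub>R w \<in> V"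
  shows "smooth_on J (\<lambda>t. g (a + t *\<^sub>R w))"
  unfolding smooth_on_def
proof
  fix t assume t: "t \<in> J"
  let ?l = "\<lambda>t::real. a + t *\<^sub>R w"
  obtain U G where U: "open U" "?l t \<in> U" "\<forall>k. C_on k G U" "\<forall>y\<in>V \<inter> U. G y = g y"
    using assms t unfolding smooth_on_def by meson
  have "open (?l -` U)"
    by (intro open_vimage continuous_intros U(1))
  moreover have "\<forall>k. C_on k (\<lambda>t. G (?l t)) (?l -` U)"
    using U C_on_compose_line by blast
  ultimately show "\<exists>U' g'. open U' \<and> t \<in> U' \<and> (\<forall>k. C_on k g' U') \<and> (\<forall>y\<in>J \<inter> U'. g' y = g (?l y))"
    using U assms(2) by (intro exI[of _ "?l -` U"] exI[of _ "\<lambda>t. G (?l t)"]) auto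
qed

text \<open>The derivative of a local smooth extension serves as \<open>D\<close>. On a submanifold
  of lower dimension \<open>D\<close> need not be unique, since extensions may differ in normal
  directions.\<close>

lemma smooth_on_has_derivative:
  assumes "smooth_on A f" "x \<in> A"
  obtains D where "(f has_derivative D) (at x within A)"
proof -
  obtain U g where U: "open U" "x \<in> U" "\<forall>k. C_on k g U" "\<forall>y\<in>A \<inter> U. g y = f y"
    using assms unfolding smooth_on_def by meson
  have "g differentiable_on U"
    using U(3) C_on.simps(2) by blast
  then have "g differentiable at x"
    using U(1,2) by (simp add: differentiable_on_eq_differentiable_at)
  then obtain D where D: "(g has_derivative D) (at x within A)"
    using has_derivative_at_withinI unfolding differentiable_def by blast
  obtain e where "e > 0" "ball x e \<subseteq> U"
    using U open_contains_ball by blast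
  then have "(f has_derivative D) (at x within A)"
    using D U by (intro has_derivative_transform_within[OF D \<open>e > 0\<close> assms(2)])
      (auto simp: subset_iff dist_commute)
  then show thesis ..
qed

section \<open>Tangent spaces of a submanifold\<close>

lemma has_vector_derivative_in_subspace:
  fixes g :: "real \<Rightarrow> 'a::euclidean_space"
  assumes "(g has_vector_derivative X) (at s within J)" "at s within J \<noteq> bot"
    and "subspace S" "g s \<in> S" "eventually (\<lambda>t. g t \<in> S) (at s within J)"
  shows "X \<in> S"
proof (rule Lim_in_closed_set)
  show "closed S"
    using assms closed_subspace by blast
  show "eventually (\<lambda>t. (g t - g s) /\<^sub>R (t - s) \<in> S) (at s within J)"
    using assms(5)
  proof eventually_elim
    case (elim t)
    then show ?case
      using assms(3,4) by (simp add: subspace_diff subspace_scale)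
  qed
  have "((\<lambda>t. (g t - g s - (t - s) *\<^sub>R X) /\<^sub>R norm (t - s)) \<longlongrightarrow> 0) (at s within J)"
    using assms(1) by (simp add: has_vector_derivative_def has_derivative_at_within)
  then have *: "((\<lambda>t. norm ((g t - g s - (t - s) *\<^sub>R X) /\<^sub>R norm (t - s))) \<longlongrightarrow> 0) (at s within J)"
    by (rule tendsto_norm_zero)
  \<comment> \<open>Dividing by \<open>norm (t - s)\<close> instead of \<open>t - s\<close> changes
    at most the sign, which the norm removes. This also covers one-sided limits from the
    left.\<close>
  have "((\<lambda>t. norm ((g t - g s) /\<^sub>R (t - s) - X)) \<longlongrightarrow> 0) (at s within J)"
  proof (rule Lim_transform_eventually[OF *])
    show "eventually (\<lambda>t. norm ((g t - g s - (t - s) *\<^sub>R X) /\<^sub>R norm (t - s)) =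
        norm ((g t - g s) /\<^sub>R (t - s) - X)) (at s within J)"
      unfolding eventually_at_filter
    proof (intro always_eventually allI impI)
      fix t assume "t \<noteq> s" "t \<in> J"
      then have "(g t - g s) /\<^sub>R (t - s) - X = (g t - g s - (t - s) *\<^sub>R X) /\<^sub>R (t - s)"
        by (simp add: scaleR_diff_right)
      then show "norm ((g t - g s - (t - s) *\<^sub>R X) /\<^sub>R norm (t - s)) =
          norm ((g t - g s) /\<^sub>R (t - s) - X)"
        by simp
    qed
  qed
  then show "((\<lambda>t. (g t - g s) /\<^sub>R (t - s)) \<longlongrightarrow> X) (at s within J)"
    using Lim_null tendsto_norm_zero_iff by blast
qed (use assms in auto)

text \<open>A straightening chart \<open>h\<close> with inverse \<open>h'\<close> identifies the tangent space with the preimage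
  of \<open>S\<close> under the differential of \<open>h\<close>. The velocity of a curve in \<open>M\<close> is tangent even if it is
  only one-sided, because \<open>S\<close> is closed.\<close>

lemma submanifold_tangent_space:
  fixes M :: "'a::euclidean_space set"
  assumes "submanifold k M" "p \<in> M"
  shows "subspace (tangent_space M p)"
    and "\<And>J \<gamma> s X. \<lbrakk>(\<gamma> has_vector_derivative X) (at s within J); at s within J \<noteq> bot;
      \<gamma> ` J \<subseteq> M; \<gamma> s = p\<rbrakk> \<Longrightarrow> X \<in> tangent_space M p"
proof -
  obtain U and V :: "'a set" and h h' S where chart: "open U" "p \<in> U" "open V" "homeomorphism U V h h'"
    "smooth_on U h" "smooth_on V h'" "subspace S" "h ` (U \<inter> M) = V \<inter> S"
    using assms unfolding submanifold_def by meson
  have inv: "\<And>x. x \<in> U \<Longrightarrow> h' (h x) = x" "\<And>y. y \<in> V \<Longrightarrow> h (h' y) = y"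
      and maps: "\<And>x. x \<in> U \<Longrightarrow> h x \<in> V" "\<And>y. y \<in> V \<Longrightarrow> h' y \<in> U"
    using chart(4) by (auto simp: homeomorphism_def)
  have hp: "h p \<in> V" "h p \<in> S"
    using chart assms by auto
  obtain H where H: "(h has_derivative H) (at p)"
    using smooth_on_has_derivative[OF chart(5,2)] at_within_open[OF chart(2,1)] by metis
  obtain H' where H': "(h' has_derivative H') (at (h p))"
    using smooth_on_has_derivative[OF chart(6) hp(1)] at_within_open[OF hp(1) chart(3)] by metis
  \<comment> \<open>Differentiating \<open>h' (h x) = x\<close> makes \<open>H'\<close> a left
    inverse of \<open>H\<close>; it recovers \<open>X\<close> from \<open>H X\<close> when a curve
    with velocity \<open>X\<close> is built.\<close>
  have "((h' \<circ> h) has_derivative (H' \<circ> H)) (at p)"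
    using diff_chain_at H H' by blast
  moreover have "((h' \<circ> h) has_derivative id) (at p)"
    by (rule has_derivative_transform_within_open[OF has_derivative_id chart(1,2)])
      (simp add: inv)
  ultimately have "H' \<circ> H = id"
    using has_derivative_unique by blast
  then have H'H: "H' (H X) = X" for X
    by (metis comp_apply id_apply)
  have lin: "linear H"
    using H has_derivative_linear by blast
  have in_S: "H X \<in> S"
    if \<gamma>: "(\<gamma> has_vector_derivative X) (at s within J)" "at s within J \<noteq> bot"
      "\<gamma> s = p" "\<gamma> ` J \<subseteq> M" for \<gamma> s J X
  proof (rule has_vector_derivative_in_subspace)
    show "((h \<circ> \<gamma>) has_vector_derivative H X) (at s within J)"
      using \<gamma> H by (intro vector_derivative_diff_chain_within) (auto intro: has_derivative_at_withinI)
    show "(h \<circ> \<gamma>) s \<in> S"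
      using \<gamma> hp by simp
    have "(\<gamma> \<longlongrightarrow> p) (at s within J)"
      using has_vector_derivative_continuous[OF \<gamma>(1)] \<gamma>(3) by (simp add: continuous_within)
    then have "eventually (\<lambda>t. \<gamma> t \<in> U) (at s within J)"
      using chart topological_tendstoD by blast
    moreover have "eventually (\<lambda>t. t \<in> J) (at s within J)"
      by (simp add: eventually_at_filter)
    ultimately show "eventually (\<lambda>t. (h \<circ> \<gamma>) t \<in> S) (at s within J)"
    proof eventually_elim
      case (elim t)
      then have "\<gamma> t \<in> U \<inter> M"
        using \<gamma>(4) by auto
      then show ?case
        using chart(8) by fastforce
    qed
  qed (use \<gamma> chart in auto)
  have "H X \<in> S" if X: "X \<in> tangent_space M p" for X
  proof -
    obtain \<gamma> e where \<gamma>: "e > 0" "\<gamma> ` {-e<..<e} \<subseteq> M" "\<gamma> 0 = p"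
        "(\<gamma> has_vector_derivative X) (at 0)"
      using X by (auto simp: tangent_space_def represents_def)
    have "at 0 within {-e<..<e} = at (0::real)"
      using \<gamma> by (intro at_within_open) auto
    then show ?thesis
      using in_S[of \<gamma> X 0 "{-e<..<e}"] \<gamma> by simp
  qed
  moreover have tangentI: "X \<in> tangent_space M p" if X: "H X \<in> S" for X
  proof -
    \<comment> \<open>The representing curve is the straight line through \<open>h p\<close> in
      direction \<open>H X\<close>, which stays in \<open>S\<close>, pulled back by the chart. Its
      velocity at 0 is \<open>H' (H X) = X\<close>.\<close>
    let ?l = "\<lambda>t::real. h p + t *\<^sub>R H X"
    let ?\<gamma> = "\<lambda>t. h' (?l t)"
    have "open (?l -` V)"
      by (intro open_vimage continuous_intros chart)
    moreover have "0 \<in> ?l -` V"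
      using hp by simp
    ultimately obtain e where e: "e > 0" "ball 0 e \<subseteq> ?l -` V"
      using open_contains_ball by blast
    then have l: "?l t \<in> V" if "t \<in> {-e<..<e}" for t
      using that by (auto simp: subset_iff)
    have "?\<gamma> t \<in> M" if "t \<in> {-e<..<e}" for t
    proof -
      have "?l t \<in> V \<inter> S"
        using l[OF that] hp X chart by (auto intro: subspace_add subspace_scale)
      then obtain x where "x \<in> U \<inter> M" "?l t = h x"
        using chart(8) by (metis imageE)
      then show ?thesis
        using inv by auto
    qed
    moreover have "smooth_on {-e<..<e} ?\<gamma>"
      by (rule smooth_on_compose_line[OF chart(6) l])
    moreover have "(?\<gamma> has_vector_derivative X) (at 0)"
    proof -
      have "(?l has_vector_derivative H X) (at 0)"
        by (auto intro!: derivative_eq_intros)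
      moreover have "(h' has_derivative H') (at (?l 0) within range ?l)"
        using H' by (auto intro: has_derivative_at_withinI)
      ultimately show ?thesis
        using vector_derivative_diff_chain_within[of ?l "H X" 0 UNIV h' H'] H'H
        by (simp add: o_def)
    qed
    ultimately have "represents M p ?\<gamma> X"
      using e chart(2) inv unfolding represents_def by auto
    then show ?thesis
      unfolding tangent_space_def by blast
  qed
  ultimately have "tangent_space M p = {X. H X \<in> S}"
    by blast
  then show "subspace (tangent_space M p)"
    using linear_subspace_linear_preimage[OF lin chart(7)] by simp
  show "X \<in> tangent_space M p"
    if "(\<gamma> has_vector_derivative X) (at s within J)" "at s within J \<noteq> bot"
      "\<gamma> ` J \<subseteq> M" "\<gamma> s = p" for J \<gamma> s X
    using tangentI in_S that by blast
qed

section \<open>Differential and gradient\<close>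

text \<open>By the chain rule every curve representing \<open>X\<close> gives the derivative
  \<open>D X\<close>, so all choices of \<open>D\<close> agree on tangent vectors and the definite
  description is meaningful.\<close>

lemma differential_eq:
  assumes "(f has_derivative D) (at p within M)" "X \<in> tangent_space M p"
  shows "differential M f p X = D X"
proof -
  have deriv: "((\<lambda>t. f (\<gamma> t)) has_real_derivative D X) (at 0)" if "represents M p \<gamma> X" for \<gamma>
  proof -
    obtain e where \<gamma>: "e > 0" "\<gamma> ` {-e<..<e} \<subseteq> M" "\<gamma> 0 = p"
        "(\<gamma> has_vector_derivative X) (at 0)"
      using \<open>represents M p \<gamma> X\<close> by (auto simp: represents_def)
    have at_0: "at 0 within {-e<..<e} = at (0::real)"
      using \<gamma> by (intro at_within_open) auto
    have "((f \<circ> \<gamma>) has_vector_derivative D X) (at 0 within {-e<..<e})"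
      using \<gamma> assms(1) at_0
      by (intro vector_derivative_diff_chain_within) (auto intro: has_derivative_subset)
    then show ?thesis
      using at_0 by (simp add: o_def has_real_derivative_iff_has_vector_derivative)
  qed
  \<comment> \<open>Without a representing curve the defining condition would hold vacuously for
    every real number.\<close>
  obtain \<gamma> where "represents M p \<gamma> X"
    using assms(2) by (auto simp: tangent_space_def)
  then show ?thesis
    unfolding differential_def using deriv DERIV_unique by (intro the_equality) blast+
qed

text \<open>The gradient is the tangential part of the vector representing \<open>D\<close> in the
  ambient space; the normal part pairs to zero with tangent vectors.\<close>

lemma gradient_inner:
  assumes "submanifold k M" "p \<in> M" "(f has_derivative D) (at p within M)"
    and "X \<in> tangent_space M p"
  shows "gradient M f p \<bullet> X = D X"
proof -
  let ?T = "tangent_space M p"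
  have sub: "subspace ?T"
    using submanifold_tangent_space(1) assms(1,2) .
  have lin: "linear D"
    using assms(3) has_derivative_linear by blast
  \<comment> \<open>The Riesz representative of the functional \<open>D\<close>.\<close>
  define v where "v = adjoint D 1"
  have v: "v \<bullet> Y = D Y" for Y
    using adjoint_works[OF lin, of Y 1] by (simp add: v_def inner_commute)
  obtain y z where yz: "y \<in> span ?T" "\<And>w. w \<in> span ?T \<Longrightarrow> orthogonal z w" "v = y + z"
    using orthogonal_subspace_decomp_exists[of ?T v] by metis
  have y: "y \<in> ?T"
    using yz sub by (simp add: span_eq_iff[THEN iffD2])
  have yD: "D Y = y \<bullet> Y" if "Y \<in> ?T" for Y
    using yz(2)[OF span_base[OF that]] v[of Y] yz(3) by (simp add: orthogonal_def inner_add_left)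
  have "gradient M f p = y"
    unfolding gradient_def
  proof (rule the_equality)
    show "y \<in> ?T \<and> (\<forall>Y\<in>?T. differential M f p Y = y \<bullet> Y)"
      using y yD differential_eq[OF assms(3)] by simp
    fix u assume u: "u \<in> ?T \<and> (\<forall>Y\<in>?T. differential M f p Y = u \<bullet> Y)"
    \<comment> \<open>Two candidates differ by a tangent vector that is orthogonal to
      itself.\<close>
    then have "u - y \<in> ?T"
      using y sub subspace_diff by blast
    then have "(u - y) \<bullet> (u - y) = 0"
      using u yD differential_eq[OF assms(3)] by (simp add: inner_diff_left)
    then show "u = y"
      by simp
  qed
  then show ?thesis
    using yD assms(4) by simp
qed

section \<open>Derivatives along a curve\<close>

text \<open>A connected set with more than one point has no isolated points. This makes vector
  derivatives within \<open>I\<close> unique, endpoints included.\<close>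

lemma interval_at_within_neq_bot:
  fixes I :: "real set"
  assumes "is_interval I" "interior I \<noteq> {}" "s \<in> I"
  shows "at s within I \<noteq> bot"
proof -
  have "I \<noteq> {s}"
    using assms(2) by auto
  then show ?thesis
    using connected_imp_perfect[of I s] assms is_interval_connected trivial_limit_within by blast
qed

lemma has_derivative_along_curve:
  assumes "submanifold k M" "smooth_on M f" "\<alpha> ` I \<subseteq> M" "s \<in> I" "at s within I \<noteq> bot"
    and "(\<alpha> has_vector_derivative X) (at s within I)"
  shows "((\<lambda>s. f (\<alpha> s)) has_vector_derivative gradient M f (\<alpha> s) \<bullet> X) (at s within I)"
proof -
  have p: "\<alpha> s \<in> M"
    using assms by auto
  obtain D where D: "(f has_derivative D) (at (\<alpha> s) within M)"
    using smooth_on_has_derivative[OF assms(2) p] .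
  have "((f \<circ> \<alpha>) has_vector_derivative D X) (at s within I)"
    using assms D by (intro vector_derivative_diff_chain_within) (auto intro: has_derivative_subset)
  moreover have "gradient M f (\<alpha> s) \<bullet> X = D X"
    using gradient_inner[OF assms(1) p D]
      submanifold_tangent_space(2)[OF assms(1) p assms(6,5,3)] by simp
  ultimately show ?thesis
    by (simp add: o_def)
qed

section \<open>Comparison of the two helix conditions\<close>

text \<open>The expression is \<open>sin (arctan x)\<close>, and sine is injective on the range of
  arctan.\<close>

lemma divide_sqrt_one_plus_square_inject:
  fixes x y :: real
  shows "x / sqrt (1 + x\<^sup>2) = y / sqrt (1 + y\<^sup>2) \<longleftrightarrow> x = y"
proof
  assume "x / sqrt (1 + x\<^sup>2) = y / sqrt (1 + y\<^sup>2)"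
  then have "sin (arctan x) = sin (arctan y)"
    by (simp add: sin_arctan)
  then show "x = y"
    using sin_inj_pi arctan_bounded by (metis arctan_eq_iff less_imp_le minus_divide_left)
qed simp

text \<open>If the gradient were orthogonal to the tangent (or zero) all along the curve, the angle
  would be constantly \<open>pi / 2\<close> and the left side true, while
  \<open>general_helix\<close> excludes that angle. The hypothesis \<open>not_orthogonal\<close>
  rules this out by a single point and does not presuppose that the angle is constant.\<close>

theorem theorem3p3:
  fixes M :: "(real ^ 'n) set" and k :: nat
    and f :: "real ^ 'n \<Rightarrow> real"
    and I :: "real set" and \<alpha> :: "real \<Rightarrow> real ^ 'n"
  assumes "submanifold k M"
    and "smooth_on M f"
    and "eikonal M f"
    and "is_interval I" and "interior I \<noteq> {}"
    and "unit_speed_curve M I \<alpha>"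
    and not_orthogonal: "\<exists>s\<in>I. gradient M f (\<alpha> s) \<bullet> unit_tangent I \<alpha> s \<noteq> 0"
  shows "eikonal_helix_curve M f I \<alpha> \<longleftrightarrow>
    general_helix I (\<lambda>s. graph_map f (\<alpha> s)) ((0, 1) :: (real ^ 'n) \<times> real)"
proof -
  let ?\<beta> = "\<lambda>s. graph_map f (\<alpha> s)"
  let ?d = "(0, 1) :: (real ^ 'n) \<times> real"
  define T where "T = velocity I \<alpha>"
  define c where "c s = gradient M f (\<alpha> s) \<bullet> T s" for s
  have \<alpha>: "smooth_on I \<alpha>" "\<alpha> ` I \<subseteq> M" "\<And>s. s \<in> I \<Longrightarrow> norm (T s) = 1"
    using assms(6) by (auto simp: unit_speed_curve_def T_def)
  have ut: "unit_tangent I \<alpha> s = T s" if "s \<in> I" for s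
    using \<alpha>(3)[OF that] by (simp add: unit_tangent_def T_def)
  have nontriv: "at s within I \<noteq> bot" if "s \<in> I" for s
    using interval_at_within_neq_bot[OF assms(4,5) that] .
  have \<alpha>_deriv: "(\<alpha> has_vector_derivative T s) (at s within I)" if "s \<in> I" for s
  proof -
    have "\<alpha> differentiable (at s within I)"
      using smooth_on_has_derivative[OF \<alpha>(1) that] differentiable_def by metis
    then show ?thesis
      by (simp add: T_def velocity_def vector_derivative_works)
  qed
  have \<beta>_deriv: "(?\<beta> has_vector_derivative (T s, c s)) (at s within I)" if "s \<in> I" for s
    unfolding graph_map_def c_def
    using that \<alpha>_deriv has_derivative_along_curve[OF assms(1,2) \<alpha>(2) that nontriv[OF that]]
    by (intro has_vector_derivative_Pair) auto
  have \<beta>_vel: "velocity I ?\<beta> s = (T s, c s)" if "s \<in> I" for s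
    unfolding velocity_def using vector_derivative_within[OF nontriv \<beta>_deriv] that by blast
  have \<beta>_cos: "unit_tangent I ?\<beta> s \<bullet> ?d = c s / sqrt (1 + (c s)\<^sup>2)" if "s \<in> I" for s
    using \<alpha>(3)[OF that] by (simp add: unit_tangent_def \<beta>_vel[OF that] norm_Pair divide_inverse_commute)
  obtain g where g: "norm (gradient M f p) = g" if "p \<in> M" for p
    using assms(3) by (auto simp: eikonal_def constant_on_def)
  obtain s0 where s0: "s0 \<in> I" "c s0 \<noteq> 0"
    using not_orthogonal ut by (auto simp: c_def)
  have grad: "norm (gradient M f (\<alpha> s)) = g" if "s \<in> I" for s
    using g \<alpha>(2) that by blast
  have c_le: "\<bar>c s\<bar> \<le> g" if "s \<in> I" for s
    using Cauchy_Schwarz_ineq2[of "gradient M f (\<alpha> s)" "T s"] grad[OF that] \<alpha>(3)[OF that]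
    by (simp add: c_def)
  \<comment> \<open>Positivity comes from \<open>s0\<close> and Cauchy-Schwarz. Hence dividing by
    \<open>g\<close> loses nothing, and all quotients lie in [-1, 1], where arccos is
    injective.\<close>
  have "g > 0"
    using c_le[OF s0(1)] s0(2) by linarith
  then have c_range: "\<bar>c s / g\<bar> \<le> 1" if "s \<in> I" for s
    using c_le[OF that] by simp
  have angle: "vec_angle (gradient M f (\<alpha> s)) (unit_tangent I \<alpha> s) = arccos (c s / g)" if "s \<in> I" for s
    using that by (simp add: vec_angle_def ut grad \<alpha>(3) c_def)
  have eik: "eikonal_helix_curve M f I \<alpha> \<longleftrightarrow> (\<forall>s\<in>I. c s = c s0)"
  proof -
    have "eikonal_helix_curve M f I \<alpha> \<longleftrightarrow> (\<lambda>s. arccos (c s / g)) constant_on I"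
      using grad angle by (auto simp: eikonal_helix_curve_def constant_on_def)
    also have "\<dots> \<longleftrightarrow> (\<forall>s\<in>I. arccos (c s / g) = arccos (c s0 / g))"
      using s0(1) by (auto simp: constant_on_def)
    also have "\<dots> \<longleftrightarrow> (\<forall>s\<in>I. c s = c s0)"
      using c_range s0(1) \<open>g > 0\<close> by (simp add: arccos_eq_iff)
    finally show ?thesis .
  qed
  have helix: "general_helix I ?\<beta> ?d \<longleftrightarrow>
    (\<exists>\<phi>. 0 \<le> \<phi> \<and> \<phi> \<le> pi \<and> \<phi> \<noteq> pi / 2 \<and> (\<forall>s\<in>I. c s / sqrt (1 + (c s)\<^sup>2) = cos \<phi>))"
  proof -
    \<comment> \<open>The velocity cannot vanish because its first component \<open>T s\<close> has
      norm 1.\<close>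
    have "?\<beta> differentiable (at s within I) \<and> velocity I ?\<beta> s \<noteq> 0" if "s \<in> I" for s
      using \<beta>_deriv[OF that] \<beta>_vel[OF that] \<alpha>(3)[OF that]
      by (auto simp: zero_prod_def intro: differentiableI_vector)
    then show ?thesis
      using \<beta>_cos by (auto simp: general_helix_def norm_Pair)
  qed
  show ?thesis
  proof
    assume "eikonal_helix_curve M f I \<alpha>"
    then have const: "\<forall>s\<in>I. c s = c s0"
      using eik by simp
    let ?u = "c s0 / sqrt (1 + (c s0)\<^sup>2)"
    have u: "-1 \<le> ?u" "?u \<le> 1"
      unfolding sin_arctan[symmetric] by simp_all
    \<comment> \<open>The choice of \<open>s0\<close> makes the common cosine nonzero, which is
      exactly what keeps its angle away from \<open>pi / 2\<close>.\<close>
    have "sqrt (1 + (c s0)\<^sup>2) \<noteq> 0"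
      by (simp add: add_nonneg_eq_0_iff)
    then have "?u \<noteq> 0"
      using s0(2) by simp
    then have "arccos ?u \<noteq> pi / 2"
      using cos_arccos[OF u] by force
    moreover have "0 \<le> arccos ?u" "arccos ?u \<le> pi"
      using arccos_bounded[OF u] by auto
    ultimately show "general_helix I ?\<beta> ?d"
      unfolding helix using const cos_arccos[OF u] by (intro exI[of _ "arccos ?u"]) simp
  next
    assume "general_helix I ?\<beta> ?d"
    \<comment> \<open>Both sides equal the cosine of the helix angle; injectivity then gives
      constancy of \<open>c\<close>.\<close>
    then have "\<forall>s\<in>I. c s / sqrt (1 + (c s)\<^sup>2) = c s0 / sqrt (1 + (c s0)\<^sup>2)"
      using s0(1) unfolding helix by fastforce
    then show "eikonal_helix_curve M f I \<alpha>"
      unfolding eik divide_sqrt_one_plus_square_inject by blast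
  qed
qed

end
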